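(* Let $\mathcal{R}=\{\mathcal{R}_\tau\}_{\tau\in\mathbb{R}}$, $\mathcal{R}_\tau\subset C([\tau,+\infty),X)$, satisfy properties $(K1)$, $(K2)$ and $(K4)$ (stated in the context), and let $U$ be the associated multivalued process. Assume that $U$ is strongly order preserving and possesses a pullback attractor $\{\mathcal{A}(t)\}_{t\in\mathbb{R}}$. Let $\underline{u},\overline{u}:\mathbb{R}\to X$ be, respectively, a complete sub-trajectory and a complete super-trajectory for $U$ such that $\underline{u}(t)\le\overline{u}(t)$ for all $t\in\mathbb{R}$, and such that for all $t\in\mathbb{R}$ $$\mathcal{A}(t)\subset I_{\underline{u}}^{\overline{u}}(t),$$ $$dist_X(U(t,s,\underline{u}(s)),\mathcal{A}(t))\to 0\quad\text{and}\quad dist_X(U(t,s,\overline{u}(s)),\mathcal{A}(t))\to 0\quad\text{as } s\to-\infty .$$ Then there exist complete orbits $\gamma_\ast(\cdot),\gamma^\ast(\cdot)$ of $\mathcal{R}$ such that: 1. $\gamma_\ast(t),\gamma^\ast(t)\in\mathcal{A}(t)$ and $\mathcal{A}(t)\subset I_{\gamma_\ast}^{\gamma^\ast}(t)$ for all $t\in\mathbb{R}$. If, moreover, $\cup_{s\in\mathbb{R}}\mathcal{A}(s)$ is a bounded set in $X$, then $\gamma_\ast$ and $\gamma^\ast$ are bounded. 2. $\underline{u}(t)\le\gamma_\ast(t)\le\gamma^\ast(t)\le\overline{u}(t)$ for every $t\in\mathbb{R}$. 3. $\gamma_\ast$ is minimal in the sense that there is no complete orbit $\gamma$ other than $\gamma_\ast$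 such that $\underline{u}(t)\le\gamma(t)\le\gamma_\ast(t)$ for all $t\in\mathbb{R}$; and $\gamma^\ast$ is maximal in the sense that there is no complete orbit $\gamma$ other than $\gamma^\ast$ such that $\gamma^\ast(t)\le\gamma(t)\le\overline{u}(t)$ for all $t\in\mathbb{R}$. 4. If for every $s\in\mathbb{R}$ the function $\gamma_\ast|_{[s,+\infty)}$ is the unique function in $\mathcal{R}_s$ taking the value $\gamma_\ast(s)$ at time $s$, then $\gamma_\ast$ is globally asymptotically stable from below, i.e. for every $t\in\mathbb{R}$ $$\lim_{\tau\to-\infty}dist_X(U(t,\tau,v_\tau),\gamma_\ast(t))=0$$ whenever $v_\tau\in X$ with $\underline{u}(\tau)\le v_\tau\le\gamma_\ast(\tau)$ for all $\tau\in\mathbb{R}$. Likewise, if for every $s\in\mathbb{R}$ the function $\gamma^\ast|_{[s,+\infty)}$ is the unique function in $\mathcal{R}_s$ taking the value $\gamma^\ast(s)$ at time $s$, then $\gamma^\ast$ is globally asymptotically stable from above, i.e. for every $t\in\mathbb{R}$ $$\lim_{\tau\to-\infty}dist_X(U(t,\tau,v_\tau),\gamma^\ast(t))=0$$ whenever $v_\tau\in X$ with $\overline{u}(\tau)\ge v_\tau\ge\gamma^\ast(\tau)$ for all $\tau\in\mathbb{R}$.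
   Context: $X$ is a partially ordered complete metric space with metric $\rho$ and order $\le$ compatible with the topology in the following sense: (1) for any bounded set $B$ there exist $a,b\in X$ such that $B\subset[a,b]:=\{x\in X: a\le x\le b\}$; (2) if $x_n\to x$, $y_n\to y$ and $x_n\le y_n$, then $x\le y$; (3) if $u\le v\le w$, then $\rho(u,v)\le\rho(u,w)$ and $\rho(v,w)\le\rho(u,w)$. $P(X)$ is the set of non-empty subsets of $X$, $\mathbb{R}_d=\{(t,s)\in\mathbb{R}^2:t\ge s\}$, and $dist_X(B,A)=\sup_{b\in B}\inf_{a\in A}\rho(b,a)$ (a point is identified with the singleton containing it). Properties of a family $\mathcal{R}=\{\mathcal{R}_\tau\}_{\tau\in\mathbb{R}}$, $\mathcal{R}_\tau\subset C([\tau,+\infty),X)$: $(K1)$ For any $\tau\in\mathbb{R}$ and $x\in X$ there exists $\varphi\in\mathcal{R}_\tau$ such that $\varphi(\tau)=x$. $(K2)$ $\varphi|_{[\tau+s,\infty)}\in\mathcal{R}_{\tau+s}$ for any $s\ge0$, $\varphi\in\mathcal{R}_\tau$. $(K4)$ For any sequence $\varphi^n\in\mathcal{R}_\tau$ such that $\varphi^n(\tau)\to\varphi_0$ in $X$, there exist a subsequence $\varphi^{n_k}$ and $\varphi\in\mathcal{R}_\tau$ such that $\varphi(\tau)=\varphi_0$ and $\varphi^{n_k}(t)\to\varphi(t)$ for all $t\ge\tau$. The multivalued process $U:\mathbb{R}_d\times X\to P(X)$ associated with $\mathcal{R}$ is $U(t,s,x)=\{u(t):u\in\mathcal{R}_s,\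 u(s)=x\}$; for $B\subset X$, $U(t,s,B)=\cup_{x\in B}U(t,s,x)$. $U$ is strongly order preserving if for any $\tau\in\mathbb{R}$ and $x_\tau\le y_\tau$ in $X$ there exist $\underline{\varphi},\overline{\varphi}\in\mathcal{R}_\tau$ with $\underline{\varphi}(\tau)=x_\tau$, $\overline{\varphi}(\tau)=y_\tau$ such that $\underline{\varphi}(t)\le y(t)$ and $x(t)\le\overline{\varphi}(t)$ for all $t\ge\tau$ and for all $x(\cdot),y(\cdot)\in\mathcal{R}_\tau$ with $x(\tau)=x_\tau$, $y(\tau)=y_\tau$. A family of compact sets $\{\mathcal{A}(t)\}_{t\in\mathbb{R}}$ is a pullback attractor for $U$ if: (i) it is pullback attracting: $dist_X(U(t,s,B),\mathcal{A}(t))\to0$ as $s\to-\infty$ for any $t\in\mathbb{R}$ and any bounded set $B$; (ii) $\mathcal{A}(t)\subset U(t,s,\mathcal{A}(s))$ for all $s\le t$; (iii) if $\{\mathcal{K}(t)\}_{t\in\mathbb{R}}$ is another pullback attracting family of closed sets, then $\mathcal{A}(t)\subset\mathcal{K}(t)$ for any $t\in\mathbb{R}$. A complete orbit (complete trajectory) of $\mathcal{R}$ is a map $\gamma:\mathbb{R}\to X$ with $\gamma|_{[\tau,+\infty)}\in\mathcal{R}_\tau$ for all $\tau\in\mathbb{R}$; it is bounded if $\cup_{t\in\mathbb{R}}\gamma(t)$ is a bounded set. $\underline{u}:\mathbb{R}\to X$ is a complete sub-trajectory for $U$ if $\underline{u}(t)\le y$ for all $y\in U(t,s,\underline{u}(s))$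 and all $t\ge s$. $\overline{u}:\mathbb{R}\to X$ is a complete super-trajectory (upper complete trajectory) for $U$ if $\overline{u}(t)\ge y$ for all $y\in U(t,s,\overline{u}(s))$ and all $t\ge s$. For functions $\alpha,\beta:\mathbb{R}\to X$ with $\alpha(t)\le\beta(t)$ for all $t$, $I_\alpha^\beta(t)=\{y\in X:\alpha(t)\le y\le\beta(t)\}$. *)

theory Defs
  imports "HOL-Analysis.Analysis"
begin

class order_complete_metric_space = complete_space + order +
  assumes bounded_subset_order_interval: "bounded B \<Longrightarrow> \<exists>a b. B \<subseteq> {x. a \<le> x \<and> x \<le> b}"
    and order_closed_sequentially:
      "\<lbrakk>X \<longlonglongrightarrow> x; Y \<longlonglongrightarrow> y; \<And>n::nat. X n \<le> Y n\<rbrakk> \<Longrightarrow> x \<le> y"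
    and dist_mono_left: "\<lbrakk>u \<le> v; v \<le> w\<rbrakk> \<Longrightarrow> dist u v \<le> dist u w"
    and dist_mono_right: "\<lbrakk>u \<le> v; v \<le> w\<rbrakk> \<Longrightarrow> dist v w \<le> dist u w"

text \<open>The value is taken in $[0,\infty]$, since the first set may be unbounded.
  In particular the semidistance from a nonempty set to the empty set is $\infty$, and
  the semidistance from the empty set is $0$.\<close>

definition semidist :: "'a::metric_space set \<Rightarrow> 'a set \<Rightarrow> ennreal" where
  "semidist B A = (SUP b\<in>B. INF a\<in>A. ennreal (dist b a))"

text \<open>An element of $C([\tau,\infty),X)$ is represented by a function on the reals that is
  \<^const>\<open>undefined\<close> before $\tau$, so that equality of functions is equality on
  $[\tau,\infty)$.\<close>

definition cont_from :: "real \<Rightarrow> (real \<Rightarrow> 'a::topological_space) set" where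
  "cont_from \<tau> = {\<phi> \<in> extensional {\<tau>..}. continuous_on {\<tau>..} \<phi>}"

definition K1 :: "(real \<Rightarrow> (real \<Rightarrow> 'a) set) \<Rightarrow> bool" where
  "K1 R \<longleftrightarrow> (\<forall>\<tau> x. \<exists>\<phi>\<in>R \<tau>. \<phi> \<tau> = x)"

definition K2 :: "(real \<Rightarrow> (real \<Rightarrow> 'a) set) \<Rightarrow> bool" where
  "K2 R \<longleftrightarrow> (\<forall>\<tau>. \<forall>s\<ge>0. \<forall>\<phi>\<in>R \<tau>. restrict \<phi> {\<tau> + s..} \<in> R (\<tau> + s))"

definition K4 :: "(real \<Rightarrow> (real \<Rightarrow> 'a::topological_space) set) \<Rightarrow> bool" where
  "K4 R \<longleftrightarrow> (\<forall>\<tau> (\<Phi> :: nat \<Rightarrow> real \<Rightarrow> 'a) x0.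
     (\<forall>n. \<Phi> n \<in> R \<tau>) \<and> (\<lambda>n. \<Phi> n \<tau>) \<longlonglongrightarrow> x0 \<longrightarrow>
     (\<exists>r::nat \<Rightarrow> nat. strict_mono r \<and>
        (\<exists>\<phi>\<in>R \<tau>. \<phi> \<tau> = x0 \<and> (\<forall>t\<ge>\<tau>. (\<lambda>k. \<Phi> (r k) t) \<longlonglongrightarrow> \<phi> t))))"

text \<open>The process is meaningful only for \<open>s \<le> t\<close>; it is used only for such times and
  for limits \<open>s \<rightarrow> -\<infinity>\<close> with \<open>t\<close> fixed.\<close>

definition process :: "(real \<Rightarrow> (real \<Rightarrow> 'a) set) \<Rightarrow> real \<Rightarrow> real \<Rightarrow> 'a \<Rightarrow> 'a set" where
  "process R t s x = {u t |u. u \<in> R s \<and> u s = x}"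

definition process_set ::
    "(real \<Rightarrow> (real \<Rightarrow> 'a) set) \<Rightarrow> real \<Rightarrow> real \<Rightarrow> 'a set \<Rightarrow> 'a set" where
  "process_set R t s B = (\<Union>x\<in>B. process R t s x)"

definition strongly_order_preserving :: "(real \<Rightarrow> (real \<Rightarrow> 'a::order) set) \<Rightarrow> bool" where
  "strongly_order_preserving R \<longleftrightarrow> (\<forall>\<tau> x\<^sub>\<tau> y\<^sub>\<tau>. x\<^sub>\<tau> \<le> y\<^sub>\<tau> \<longrightarrow>
     (\<exists>\<phi>l\<in>R \<tau>. \<exists>\<phi>u\<in>R \<tau>. \<phi>l \<tau> = x\<^sub>\<tau> \<and> \<phi>u \<tau> = y\<^sub>\<tau> \<and>
        (\<forall>x\<in>R \<tau>. \<forall>y\<in>R \<tau>. x \<tau> = x\<^sub>\<tau> \<and> y \<tau> = y\<^sub>\<tau> \<longrightarrow>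
           (\<forall>t\<ge>\<tau>. \<phi>l t \<le> y t \<and> x t \<le> \<phi>u t))))"

definition pullback_attracting ::
    "(real \<Rightarrow> (real \<Rightarrow> 'a::metric_space) set) \<Rightarrow> (real \<Rightarrow> 'a set) \<Rightarrow> bool" where
  "pullback_attracting R K \<longleftrightarrow>
     (\<forall>t B. bounded B \<longrightarrow> ((\<lambda>s. semidist (process_set R t s B) (K t)) \<longlongrightarrow> 0) at_bot)"

definition pullback_attractor ::
    "(real \<Rightarrow> (real \<Rightarrow> 'a::metric_space) set) \<Rightarrow> (real \<Rightarrow> 'a set) \<Rightarrow> bool" where
  "pullback_attractor R A \<longleftrightarrow>
     (\<forall>t. compact (A t)) \<and>
     pullback_attracting R A \<and>
     (\<forall>s t. s \<le> t \<longrightarrow> A t \<subseteq> process_set R t s (A s)) \<and>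
     (\<forall>K. (\<forall>t. closed (K t)) \<and> pullback_attracting R K \<longrightarrow> (\<forall>t. A t \<subseteq> K t))"

definition complete_orbit :: "(real \<Rightarrow> (real \<Rightarrow> 'a) set) \<Rightarrow> (real \<Rightarrow> 'a) \<Rightarrow> bool" where
  "complete_orbit R \<gamma> \<longleftrightarrow> (\<forall>\<tau>. restrict \<gamma> {\<tau>..} \<in> R \<tau>)"

definition complete_sub_trajectory ::
    "(real \<Rightarrow> (real \<Rightarrow> 'a::order) set) \<Rightarrow> (real \<Rightarrow> 'a) \<Rightarrow> bool" where
  "complete_sub_trajectory R u \<longleftrightarrow> (\<forall>s t. s \<le> t \<longrightarrow> (\<forall>y\<in>process R t s (u s). u t \<le> y))"

definition complete_super_trajectory ::
    "(real \<Rightarrow> (real \<Rightarrow> 'a::order) set) \<Rightarrow> (real \<Rightarrow> 'a) \<Rightarrow> bool" where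
  "complete_super_trajectory R u \<longleftrightarrow> (\<forall>s t. s \<le> t \<longrightarrow> (\<forall>y\<in>process R t s (u s). u t \<ge> y))"

definition order_tube :: "(real \<Rightarrow> 'a::order) \<Rightarrow> (real \<Rightarrow> 'a) \<Rightarrow> real \<Rightarrow> 'a set" where
  "order_tube \<alpha> \<beta> t = {y. \<alpha> t \<le> y \<and> y \<le> \<beta> t}"

definition forward_unique :: "(real \<Rightarrow> (real \<Rightarrow> 'a) set) \<Rightarrow> (real \<Rightarrow> 'a) \<Rightarrow> bool" where
  "forward_unique R \<gamma> \<longleftrightarrow> (\<forall>s. {\<phi> \<in> R s. \<phi> s = \<gamma> s} = {restrict \<gamma> {s..}})"

end

(* The least solutions m_s issuing at time s from the sub-trajectory increase as s decreases,
   because the sub-trajectory lies below m_r for every r < s. Attraction to the compact sections of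
   the attractor gives a cluster point in A t, and the compatibility of metric and order upgrades it
   to a limit: m_s(t) -> gamma(t) as s -> -infinity. K4 makes gamma a complete orbit. Every m_s lies
   below each solution that starts above the sub-trajectory, so gamma is below A and below every
   complete orbit above the sub-trajectory. The upper orbit is the same construction for the
   reversed order, hence the abstract relation le. *)

theory Submission imports Defs begin

section \<open>Semidistance, compact sets and monotone convergence\<close>

lemma semidist_less_ennrealD:
  assumes "semidist B K < ennreal e" and "b \<in> B"
  shows "\<exists>a\<in>K. dist b a < e"
proof -
  have "(INF a\<in>K. ennreal (dist b a)) \<le> semidist B K"
    unfolding semidist_def using assms(2) by (intro SUP_upper)
  then have "(INF a\<in>K. ennreal (dist b a)) < ennreal e"
    using assms(1) by simp
  then show ?thesis
    by (auto simp: INF_less_iff ennreal_less_iff)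
qed

lemma semidist_singleton_le:
  assumes "\<And>b. b \<in> B \<Longrightarrow> dist b c \<le> e"
  shows "semidist B {c} \<le> ennreal e"
  unfolding semidist_def using assms by (auto intro!: SUP_least ennreal_leI)

text \<open>Replace each \<open>x n\<close> by a nearest point \<open>a n\<close> of
  \<open>K\<close>. Compactness gives a convergent subsequence of \<open>a\<close>, and since
  \<open>dist (x n) (a n)\<close> tends to 0, \<open>x\<close> has the same limit along it.\<close>

lemma compact_cluster_point:
  fixes x :: "nat \<Rightarrow> 'a::metric_space"
  assumes "compact K"
    and near: "\<And>e. e > 0 \<Longrightarrow> \<forall>\<^sub>F n in sequentially. \<exists>a\<in>K. dist (x n) a < e"
  obtains l r where "l \<in> K" "strict_mono (r :: nat \<Rightarrow> nat)" "(x \<circ> r) \<longlonglongrightarrow> l"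
proof -
  have "K \<noteq> {}"
    using near[of 1] eventually_happens' by fastforce
  \<comment> \<open>A nearest point does not depend on \<open>e\<close>, so one sequence
    \<open>a\<close> serves every \<open>e\<close> in \<open>near\<close>.\<close>
  have "\<exists>a\<in>K. \<forall>b\<in>K. dist (x n) a \<le> dist (x n) b" for n
    using assms(1) \<open>K \<noteq> {}\<close>
    by (intro continuous_attains_inf continuous_intros)
  then obtain a where a: "\<And>n. a n \<in> K" "\<And>n b. b \<in> K \<Longrightarrow> dist (x n) (a n) \<le> dist (x n) b"
    by metis
  have "(\<lambda>n. dist (x n) (a n)) \<longlonglongrightarrow> 0"
  proof (rule tendstoI)
    fix e :: real assume "e > 0"
    show "\<forall>\<^sub>F n in sequentially. dist (dist (x n) (a n)) 0 < e"
      using near[OF \<open>e > 0\<close>] by eventually_elim (auto intro: le_less_trans a(2))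
  qed
  moreover obtain l r where lr: "l \<in> K" "strict_mono r" "(a \<circ> r) \<longlonglongrightarrow> l"
    using assms(1) a(1) by (metis compact_def)
  ultimately have "(\<lambda>k. dist ((x \<circ> r) k) ((a \<circ> r) k)) \<longlonglongrightarrow> 0"
    using LIMSEQ_subseq_LIMSEQ[of _ 0 r] by (fastforce simp: o_def)
  then have "(\<lambda>k. dist ((x \<circ> r) k) ((a \<circ> r) k) + dist ((a \<circ> r) k) l) \<longlonglongrightarrow> 0"
    by (rule tendsto_add_zero[OF _ tendsto_dist_iff[THEN iffD1, OF lr(3)]])
  then have "(\<lambda>k. dist ((x \<circ> r) k) l) \<longlonglongrightarrow> 0"
    by (rule tendsto_sandwich[rotated 2, OF tendsto_const]) (simp_all add: dist_triangle)
  then have "(x \<circ> r) \<longlonglongrightarrow> l"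
    by (rule tendsto_dist_iff[THEN iffD2])
  then show thesis
    using that lr by blast
qed

text \<open>An abstract relation allows one construction to be run for the order and for its
  reverse. \<open>dist_mono\<close> is the half of condition (3) about the right end; under reversal
  it turns into the half about the left end, by symmetry of the metric.\<close>

locale metric_order =
  fixes le :: "'a::metric_space \<Rightarrow> 'a \<Rightarrow> bool" (infix "\<preceq>" 50)
  assumes refl: "x \<preceq> x"
    and trans: "x \<preceq> y \<Longrightarrow> y \<preceq> z \<Longrightarrow> x \<preceq> z"
    and antisym: "x \<preceq> y \<Longrightarrow> y \<preceq> x \<Longrightarrow> x = y"
    and closed: "X \<longlonglongrightarrow> x \<Longrightarrow> Y \<longlonglongrightarrow> y \<Longrightarrow> (\<And>n::nat. X n \<preceq> Y n) \<Longrightarrow> x \<preceq> y"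
    and dist_mono: "u \<preceq> v \<Longrightarrow> v \<preceq> w \<Longrightarrow> dist v w \<le> dist u w"
begin

text \<open>Compactness yields a cluster point \<open>l\<close> along the times
  \<open>- real n\<close>. Closedness of the order puts \<open>l\<close> above the whole family, so
  each earlier value is squeezed between a later one and \<open>l\<close>, and
  \<open>dist_mono\<close> bounds its distance to \<open>l\<close>.\<close>

lemma monotone_attracted_converges:
  fixes f :: "real \<Rightarrow> 'a"
  assumes "compact K"
    and mono: "\<And>r s. r \<le> s \<Longrightarrow> s \<le> t \<Longrightarrow> f s \<preceq> f r"
    and near: "\<And>e. e > 0 \<Longrightarrow> \<forall>\<^sub>F s in at_bot. \<exists>a\<in>K. dist (f s) a < e"
  shows "\<exists>l\<in>K. (f \<longlongrightarrow> l) at_bot \<and> (\<forall>s\<le>t. f s \<preceq> l)"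
proof -
  have bot: "filterlim (\<lambda>n. - real n) at_bot sequentially"
    using filterlim_real_sequentially by (simp add: filterlim_uminus_at_bot)
  have "\<forall>\<^sub>F n in sequentially. \<exists>a\<in>K. dist (f (- real n)) a < e" if "e > 0" for e
    using eventually_compose_filterlim[OF near[OF that] bot] .
  then obtain l r where lK: "l \<in> K" and r: "strict_mono (r :: nat \<Rightarrow> nat)"
    and lim: "((\<lambda>n. f (- real n)) \<circ> r) \<longlonglongrightarrow> l"
    by (rule compact_cluster_point[OF assms(1)])
  have bot_r: "filterlim (\<lambda>k. - real (r k)) at_bot sequentially"
    using filterlim_compose[OF bot filterlim_subseq[OF r]] by simp
  have upper: "f s \<preceq> l" if "s \<le> t" for s
  proof -
    have "\<forall>\<^sub>F k in sequentially. - real (r k) \<le> s"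
      using bot_r by (simp add: filterlim_at_bot)
    \<comment> \<open>\<open>closed\<close> compares all indices, so the sequence is started at
      \<open>N\<close>, where the sampling times have already dropped to at most
      \<open>s\<close>.\<close>
    then obtain N where N: "\<And>k. k \<ge> N \<Longrightarrow> - real (r k) \<le> s"
      by (auto simp: eventually_sequentially)
    have "(\<lambda>k. f (- real (r (k + N)))) \<longlonglongrightarrow> l"
      using LIMSEQ_ignore_initial_segment[OF lim, of N] by (simp add: o_def)
    then show ?thesis
      by (rule closed[OF tendsto_const]) (intro mono N that le_add2)
  qed
  moreover have "(f \<longlongrightarrow> l) at_bot"
  proof (rule tendstoI)
    fix e :: real assume "e > 0"
    have "\<forall>\<^sub>F k in sequentially. dist (f (- real (r k))) l < e"
      using tendstoD[OF lim \<open>e > 0\<close>] by simp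
    moreover have "\<forall>\<^sub>F k in sequentially. - real (r k) \<le> t"
      using bot_r by (simp add: filterlim_at_bot)
    ultimately have "\<forall>\<^sub>F k in sequentially. dist (f (- real (r k))) l < e \<and> - real (r k) \<le> t"
      by (rule eventually_conj)
    \<comment> \<open>A single time with value within \<open>e\<close> of \<open>l\<close> suffices:
      for \<open>q \<le> s\<close>, \<open>f q\<close> lies between \<open>f s\<close> and
      \<open>l\<close>.\<close>
    then obtain s where s: "dist (f s) l < e" "s \<le> t"
      using eventually_happens'[OF sequentially_bot] by blast
    show "\<forall>\<^sub>F q in at_bot. dist (f q) l < e"
      using eventually_le_at_bot[of s]
    proof eventually_elim
      case (elim q)
      then have "dist (f q) l \<le> dist (f s) l"
        using s(2) by (intro dist_mono mono upper) auto
      with s(1) show ?case by simp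
    qed
  qed
  ultimately show ?thesis
    using lK by blast
qed

end

section \<open>The orbit obtained as the limit of least solutions\<close>

locale attracted_sub_trajectory = metric_order le
  for le :: "'a::metric_space \<Rightarrow> 'a \<Rightarrow> bool" (infix "\<preceq>" 50) +
  fixes R :: "real \<Rightarrow> (real \<Rightarrow> 'a) set"
    and A :: "real \<Rightarrow> 'a set"
    and u :: "real \<Rightarrow> 'a"
  assumes R_cont: "R \<tau> \<subseteq> cont_from \<tau>"
    and K2: "K2 R" and K4: "K4 R"
    and least_solution:
      "\<exists>\<phi>\<in>R \<tau>. \<phi> \<tau> = x \<and> (\<forall>y\<in>R \<tau>. x \<preceq> y \<tau> \<longrightarrow> (\<forall>t\<ge>\<tau>. \<phi> t \<preceq> y t))"
    and greatest_solution:
      "\<exists>\<phi>\<in>R \<tau>. \<phi> \<tau> = x \<and> (\<forall>y\<in>R \<tau>. y \<tau> \<preceq> x \<longrightarrow> (\<forall>t\<ge>\<tau>. y t \<preceq> \<phi> t))"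
    and A_compact: "compact (A t)"
    and A_invariant: "s \<le> t \<Longrightarrow> A t \<subseteq> process_set R t s (A s)"
    and sub_trajectory: "s \<le> t \<Longrightarrow> y \<in> process R t s (u s) \<Longrightarrow> u t \<preceq> y"
    and A_above: "a \<in> A t \<Longrightarrow> u t \<preceq> a"
    and attracted: "((\<lambda>s. semidist (process R t s (u s)) (A t)) \<longlongrightarrow> 0) at_bot"
begin

definition least_from :: "real \<Rightarrow> real \<Rightarrow> 'a" where
  "least_from s = (SOME \<phi>. \<phi> \<in> R s \<and> \<phi> s = u s \<and>
     (\<forall>y\<in>R s. u s \<preceq> y s \<longrightarrow> (\<forall>t\<ge>s. \<phi> t \<preceq> y t)))"

lemma least_from_in_R: "least_from s \<in> R s"
  and least_from_start: "least_from s s = u s"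
  and least_from_le: "y \<in> R s \<Longrightarrow> u s \<preceq> y s \<Longrightarrow> s \<le> t \<Longrightarrow> least_from s t \<preceq> y t"
proof -
  have "\<exists>\<phi>. \<phi> \<in> R s \<and> \<phi> s = u s \<and> (\<forall>y\<in>R s. u s \<preceq> y s \<longrightarrow> (\<forall>t\<ge>s. \<phi> t \<preceq> y t))"
    using least_solution by blast
  from someI_ex[OF this, folded least_from_def]
  show "least_from s \<in> R s" "least_from s s = u s"
    "y \<in> R s \<Longrightarrow> u s \<preceq> y s \<Longrightarrow> s \<le> t \<Longrightarrow> least_from s t \<preceq> y t"
    by blast+
qed

lemma least_from_restrict: "s \<le> r \<Longrightarrow> restrict (least_from s) {r..} \<in> R r"
  using K2[unfolded K2_def, rule_format, of "r - s" "least_from s" s] least_from_in_R by simp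

lemma least_from_in_process: "least_from s t \<in> process R t s (u s)"
  unfolding process_def using least_from_in_R least_from_start by blast

text \<open>At time \<open>s\<close> the solution \<open>least_from r\<close> is above
  \<open>u s\<close>, by the sub-trajectory property. Its restriction to \<open>{s..}\<close> is a
  solution by K2, so it dominates the least solution from \<open>u s\<close>.\<close>

lemma least_from_antimono:
  assumes "r \<le> s" "s \<le> t"
  shows "least_from s t \<preceq> least_from r t"
  using least_from_le[OF least_from_restrict[OF assms(1)], of t]
    sub_trajectory[OF assms(1) least_from_in_process] assms
  by simp

lemma least_from_limit_ex:
  "\<exists>l\<in>A t. ((\<lambda>s. least_from s t) \<longlongrightarrow> l) at_bot \<and> (\<forall>s\<le>t. least_from s t \<preceq> l)"
proof (rule monotone_attracted_converges[OF A_compact least_from_antimono])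
  fix e :: real assume "e > 0"
  then have "\<forall>\<^sub>F s in at_bot. semidist (process R t s (u s)) (A t) < ennreal e"
    using attracted by (intro order_tendstoD(2)) auto
  then show "\<forall>\<^sub>F s in at_bot. \<exists>a\<in>A t. dist (least_from s t) a < e"
    by eventually_elim (auto intro: semidist_less_ennrealD least_from_in_process)
qed

text \<open>The limit is chosen separately for each \<open>t\<close>; uniqueness of limits makes the
  choice determinate. That these values form an orbit is proved in
  \<open>limit_orbit_complete\<close>.\<close>

definition limit_orbit :: "real \<Rightarrow> 'a" where
  "limit_orbit t = (SOME l. l \<in> A t \<and> ((\<lambda>s. least_from s t) \<longlongrightarrow> l) at_bot \<and>
     (\<forall>s\<le>t. least_from s t \<preceq> l))"

lemma limit_orbit_in: "limit_orbit t \<in> A t"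
  and limit_orbit_tendsto: "((\<lambda>s. least_from s t) \<longlongrightarrow> limit_orbit t) at_bot"
  and least_from_le_limit_orbit: "s \<le> t \<Longrightarrow> least_from s t \<preceq> limit_orbit t"
proof -
  have "\<exists>l. l \<in> A t \<and> ((\<lambda>s. least_from s t) \<longlongrightarrow> l) at_bot \<and> (\<forall>s\<le>t. least_from s t \<preceq> l)"
    using least_from_limit_ex by blast
  from someI_ex[OF this, folded limit_orbit_def]
  show "limit_orbit t \<in> A t" "((\<lambda>s. least_from s t) \<longlongrightarrow> limit_orbit t) at_bot"
    "s \<le> t \<Longrightarrow> least_from s t \<preceq> limit_orbit t"
    by blast+
qed

text \<open>The shift \<open>c\<close> keeps every starting time at most \<open>c\<close>:
  \<open>c = \<tau>\<close> makes all the solutions restrict to \<open>{\<tau>..}\<close>, and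
  \<open>c = t\<close> makes them all defined at \<open>t\<close>.\<close>

lemma limit_orbit_seq: "(\<lambda>n. least_from (c - real n) t) \<longlonglongrightarrow> limit_orbit t"
proof -
  have "filterlim (\<lambda>n. c - real n) at_bot sequentially"
    using filterlim_tendsto_add_at_top[OF tendsto_const[of "- c"] filterlim_real_sequentially]
    by (simp add: filterlim_uminus_at_bot)
  then show ?thesis
    using filterlim_compose[OF limit_orbit_tendsto] by blast
qed

text \<open>K4 supplies a solution \<open>\<phi>\<close> as the limit of a subsequence of the
  restricted least solutions. The full sequence already converges to \<open>limit_orbit\<close> at
  each time, so the two agree on \<open>{\<tau>..}\<close>.\<close>

lemma limit_orbit_complete: "complete_orbit R limit_orbit"
  unfolding complete_orbit_def
proof
  fix \<tau>
  have "\<forall>n. restrict (least_from (\<tau> - real n)) {\<tau>..} \<in> R \<tau>"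
    by (simp add: least_from_restrict)
  moreover have "(\<lambda>n. restrict (least_from (\<tau> - real n)) {\<tau>..} \<tau>) \<longlonglongrightarrow> limit_orbit \<tau>"
    using limit_orbit_seq by simp
  ultimately obtain r \<phi> where r: "strict_mono (r :: nat \<Rightarrow> nat)" and \<phi>: "\<phi> \<in> R \<tau>"
    and lim: "\<forall>t\<ge>\<tau>. (\<lambda>k. restrict (least_from (\<tau> - real (r k))) {\<tau>..} t) \<longlonglongrightarrow> \<phi> t"
    using K4[unfolded K4_def, rule_format,
        of "\<lambda>n. restrict (least_from (\<tau> - real n)) {\<tau>..}" \<tau> "limit_orbit \<tau>"]
    by blast
  have "\<phi> t = limit_orbit t" if "t \<ge> \<tau>" for t
  proof (rule LIMSEQ_unique)
    show "(\<lambda>k. least_from (\<tau> - real (r k)) t) \<longlonglongrightarrow> \<phi> t"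
      using lim that by simp
    show "(\<lambda>k. least_from (\<tau> - real (r k)) t) \<longlonglongrightarrow> limit_orbit t"
      using LIMSEQ_subseq_LIMSEQ[OF limit_orbit_seq r] by (simp add: o_def)
  qed
  \<comment> \<open>Before \<open>\<tau>\<close> both functions are \<open>undefined\<close>, so
    agreement on \<open>{\<tau>..}\<close> is equality.\<close>
  moreover have "\<phi> \<in> extensional {\<tau>..}"
    using \<phi> R_cont unfolding cont_from_def by blast
  ultimately have "restrict limit_orbit {\<tau>..} = \<phi>"
    by (intro extensionalityI[of _ "{\<tau>..}"]) auto
  with \<phi> show "restrict limit_orbit {\<tau>..} \<in> R \<tau>"
    by simp
qed

text \<open>With \<open>least_from_le_limit_orbit\<close> this makes \<open>limit_orbit t\<close>
  the supremum of the values \<open>least_from s t\<close> with \<open>s \<le> t\<close>.\<close>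

lemma limit_orbit_least:
  assumes "\<And>s. s \<le> t \<Longrightarrow> least_from s t \<preceq> y"
  shows "limit_orbit t \<preceq> y"
  by (rule closed[OF limit_orbit_seq[of t] tendsto_const]) (use assms in simp)

text \<open>By invariance \<open>a\<close> is reached from a point of \<open>A s\<close> for each
  \<open>s \<le> t\<close>. That point is above \<open>u s\<close>, so \<open>a\<close> dominates
  every \<open>least_from s t\<close>.\<close>

lemma limit_orbit_le_attractor:
  assumes "a \<in> A t"
  shows "limit_orbit t \<preceq> a"
proof (rule limit_orbit_least)
  fix s assume "s \<le> t"
  then obtain y where "y \<in> R s" "y s \<in> A s" "a = y t"
    using A_invariant[of s t] assms unfolding process_set_def process_def by blast
  then show "least_from s t \<preceq> a"
    using least_from_le A_above \<open>s \<le> t\<close> by blast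
qed

text \<open>A complete orbit above \<open>u\<close> dominates each \<open>least_from s\<close>,
  hence their supremum; antisymmetry finishes.\<close>

lemma limit_orbit_minimal:
  assumes "complete_orbit R \<gamma>" "\<And>t. u t \<preceq> \<gamma> t" "\<And>t. \<gamma> t \<preceq> limit_orbit t"
  shows "\<gamma> = limit_orbit"
proof
  fix t
  have "least_from s t \<preceq> \<gamma> t" if "s \<le> t" for s
    using least_from_le[of "restrict \<gamma> {s..}" s t] assms(1,2) that
    by (simp add: complete_orbit_def)
  then show "\<gamma> t = limit_orbit t"
    by (intro antisym assms(3) limit_orbit_least)
qed

text \<open>Solutions from \<open>v \<tau>\<close> are trapped between
  \<open>least_from \<tau>\<close> and \<open>limit_orbit\<close>. By \<open>dist_mono\<close> the
  gap between these two bounds the semidistance, and it closes as \<open>\<tau>\<close> goes to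
  minus infinity.\<close>

lemma limit_orbit_stable:
  assumes uniq: "forward_unique R limit_orbit"
    and v: "\<And>\<tau>. u \<tau> \<preceq> v \<tau>" "\<And>\<tau>. v \<tau> \<preceq> limit_orbit \<tau>"
  shows "((\<lambda>\<tau>. semidist (process R t \<tau> (v \<tau>)) {limit_orbit t}) \<longlongrightarrow> 0) at_bot"
proof (rule tendsto_sandwich[of "\<lambda>_. 0"])
  have "semidist (process R t \<tau> (v \<tau>)) {limit_orbit t} \<le> ennreal (dist (least_from \<tau> t) (limit_orbit t))"
    if "\<tau> \<le> t" for \<tau>
  proof (rule semidist_singleton_le)
    fix b assume "b \<in> process R t \<tau> (v \<tau>)"
    then obtain y where y: "y \<in> R \<tau>" "y \<tau> = v \<tau>" "b = y t"
      unfolding process_def by blast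
    obtain \<phi> where \<phi>: "\<phi> \<in> R \<tau>" "\<phi> \<tau> = limit_orbit \<tau>"
      "\<And>y t. y \<in> R \<tau> \<Longrightarrow> y \<tau> \<preceq> limit_orbit \<tau> \<Longrightarrow> t \<ge> \<tau> \<Longrightarrow> y t \<preceq> \<phi> t"
      using greatest_solution by metis
    \<comment> \<open>Uniqueness enters here: the greatest solution from
      \<open>limit_orbit \<tau>\<close> must be the orbit itself, which therefore bounds
      \<open>y\<close> from above.\<close>
    have "\<phi> = restrict limit_orbit {\<tau>..}"
      using uniq \<phi>(1,2) unfolding forward_unique_def by blast
    then have "b \<preceq> limit_orbit t"
      using \<phi>(3)[OF y(1)] y v(2) that by auto
    moreover have "least_from \<tau> t \<preceq> b"
      using least_from_le[OF y(1)] y v(1) that by simp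
    ultimately show "dist b (limit_orbit t) \<le> dist (least_from \<tau> t) (limit_orbit t)"
      by (intro dist_mono)
  qed
  then show "\<forall>\<^sub>F \<tau> in at_bot. semidist (process R t \<tau> (v \<tau>)) {limit_orbit t}
      \<le> ennreal (dist (least_from \<tau> t) (limit_orbit t))"
    by (rule eventually_mono[OF eventually_le_at_bot[of t]])
  have "((\<lambda>\<tau>. dist (least_from \<tau> t) (limit_orbit t)) \<longlongrightarrow> 0) at_bot"
    by (rule tendsto_dist_iff[THEN iffD1, OF limit_orbit_tendsto])
  then show "((\<lambda>\<tau>. ennreal (dist (least_from \<tau> t) (limit_orbit t))) \<longlongrightarrow> 0) at_bot"
    using tendsto_ennrealI[of _ 0] by simp
qed auto

end

section \<open>Extremal solutions from strong order preservation\<close>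

lemma strongly_order_preserving_least:
  assumes "strongly_order_preserving R"
  shows "\<exists>\<phi>\<in>R \<tau>. \<phi> \<tau> = x \<and> (\<forall>y\<in>R \<tau>. x \<le> y \<tau> \<longrightarrow> (\<forall>t\<ge>\<tau>. \<phi> t \<le> y t))"
proof -
  \<comment> \<open>Equal initial values \<open>x\<close>, \<open>x\<close> in the definition give a
    solution below all others from \<open>x\<close>.\<close>
  obtain \<phi> where \<phi>: "\<phi> \<in> R \<tau>" "\<phi> \<tau> = x"
    "\<And>y t. y \<in> R \<tau> \<Longrightarrow> y \<tau> = x \<Longrightarrow> t \<ge> \<tau> \<Longrightarrow> \<phi> t \<le> y t"
    using assms unfolding strongly_order_preserving_def by (metis order.refl)
  have "\<phi> t \<le> y t" if y: "y \<in> R \<tau>" "x \<le> y \<tau>" "t \<ge> \<tau>" for y t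
  proof -
    \<comment> \<open>The lower solution \<open>\<psi>\<close> from the definition may depend on
      \<open>y \<tau>\<close>. Since \<open>\<phi>\<close> is below every solution from
      \<open>x\<close>, it is below each such \<open>\<psi>\<close>, so one \<open>\<phi>\<close>
      works for all \<open>y\<close>.\<close>
    obtain \<psi> where "\<psi> \<in> R \<tau>" "\<psi> \<tau> = x" "\<psi> t \<le> y t"
      using assms[unfolded strongly_order_preserving_def, rule_format, OF y(2)] y(1,3) \<phi>(1,2)
      by blast
    then show ?thesis
      using \<phi>(3) y(3) order.trans by blast
  qed
  then show ?thesis
    using \<phi>(1,2) by blast
qed

lemma strongly_order_preserving_greatest:
  assumes "strongly_order_preserving R"
  shows "\<exists>\<phi>\<in>R \<tau>. \<phi> \<tau> = x \<and> (\<forall>y\<in>R \<tau>. y \<tau> \<le> x \<longrightarrow> (\<forall>t\<ge>\<tau>. y t \<le> \<phi> t))"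
proof -
  obtain \<phi> where \<phi>: "\<phi> \<in> R \<tau>" "\<phi> \<tau> = x"
    "\<And>y t. y \<in> R \<tau> \<Longrightarrow> y \<tau> = x \<Longrightarrow> t \<ge> \<tau> \<Longrightarrow> y t \<le> \<phi> t"
    using assms unfolding strongly_order_preserving_def by (metis order.refl)
  have "y t \<le> \<phi> t" if y: "y \<in> R \<tau>" "y \<tau> \<le> x" "t \<ge> \<tau>" for y t
  proof -
    \<comment> \<open>Here \<open>\<psi>\<close> is the upper solution for the pair
      \<open>y \<tau> \<le> x\<close>; it starts at \<open>x\<close> and so stays below
      \<open>\<phi>\<close>.\<close>
    obtain \<psi> where "\<psi> \<in> R \<tau>" "\<psi> \<tau> = x" "y t \<le> \<psi> t"
      using assms[unfolded strongly_order_preserving_def, rule_format, OF y(2)] y(1,3) \<phi>(1,2)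
      by blast
    then show ?thesis
      using \<phi>(3) y(3) order.trans by blast
  qed
  then show ?thesis
    using \<phi>(1,2) by blast
qed

section \<open>Both orbits, from the order and its reverse\<close>

theorem theorem5:
  fixes R :: "real \<Rightarrow> (real \<Rightarrow> 'a::order_complete_metric_space) set"
    and A :: "real \<Rightarrow> 'a set"
    and ul uu :: "real \<Rightarrow> 'a"
  assumes "\<And>\<tau>. R \<tau> \<subseteq> cont_from \<tau>"
    and "K1 R" and "K2 R" and "K4 R"
    and "strongly_order_preserving R"
    and "pullback_attractor R A"
    and "complete_sub_trajectory R ul"
    and "complete_super_trajectory R uu"
    and "\<And>t. ul t \<le> uu t"
    and "\<And>t. A t \<subseteq> order_tube ul uu t"
    and "\<And>t. ((\<lambda>s. semidist (process R t s (ul s)) (A t)) \<longlongrightarrow> 0) at_bot"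
    and "\<And>t. ((\<lambda>s. semidist (process R t s (uu s)) (A t)) \<longlongrightarrow> 0) at_bot"
  shows "\<exists>\<gamma>l \<gamma>u. complete_orbit R \<gamma>l \<and> complete_orbit R \<gamma>u \<and>
    (\<forall>t. \<gamma>l t \<in> A t \<and> \<gamma>u t \<in> A t \<and> A t \<subseteq> order_tube \<gamma>l \<gamma>u t) \<and>
    (bounded (\<Union>s. A s) \<longrightarrow> bounded (range \<gamma>l) \<and> bounded (range \<gamma>u)) \<and>
    (\<forall>t. ul t \<le> \<gamma>l t \<and> \<gamma>l t \<le> \<gamma>u t \<and> \<gamma>u t \<le> uu t) \<and>
    \<not> (\<exists>\<gamma>. complete_orbit R \<gamma> \<and> \<gamma> \<noteq> \<gamma>l \<and> (\<forall>t. ul t \<le> \<gamma> t \<and> \<gamma> t \<le> \<gamma>l t)) \<and>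
    \<not> (\<exists>\<gamma>. complete_orbit R \<gamma> \<and> \<gamma> \<noteq> \<gamma>u \<and> (\<forall>t. \<gamma>u t \<le> \<gamma> t \<and> \<gamma> t \<le> uu t)) \<and>
    (forward_unique R \<gamma>l \<longrightarrow>
      (\<forall>v. (\<forall>\<tau>. ul \<tau> \<le> v \<tau> \<and> v \<tau> \<le> \<gamma>l \<tau>) \<longrightarrow>
        (\<forall>t. ((\<lambda>\<tau>. semidist (process R t \<tau> (v \<tau>)) {\<gamma>l t}) \<longlongrightarrow> 0) at_bot))) \<and>
    (forward_unique R \<gamma>u \<longrightarrow>
      (\<forall>v. (\<forall>\<tau>. uu \<tau> \<ge> v \<tau> \<and> v \<tau> \<ge> \<gamma>u \<tau>) \<longrightarrow>
        (\<forall>t. ((\<lambda>\<tau>. semidist (process R t \<tau> (v \<tau>)) {\<gamma>u t}) \<longlongrightarrow> 0) at_bot)))"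
proof -
  note attractor = assms(6)[unfolded pullback_attractor_def]
  have tube: "ul t \<le> a" "a \<le> uu t" if "a \<in> A t" for a t
    using assms(10) that unfolding order_tube_def by blast+
  interpret low: attracted_sub_trajectory "(\<le>)" R A ul
  proof unfold_locales
    show "x \<le> y" if "X \<longlonglongrightarrow> x" "Y \<longlonglongrightarrow> y" "\<And>n. X n \<le> Y n"
      for X Y :: "nat \<Rightarrow> 'a" and x y
      using that by (rule order_closed_sequentially)
    show "dist v w \<le> dist a w" if "a \<le> v" "v \<le> w" for a v w :: 'a
      using that by (rule dist_mono_right)
    show "ul t \<le> y" if "s \<le> t" "y \<in> process R t s (ul s)" for s t y
      using assms(7) that unfolding complete_sub_trajectory_def by blast
  qed (use assms attractor tube
      strongly_order_preserving_least[OF assms(5)]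
      strongly_order_preserving_greatest[OF assms(5)] in auto)
  \<comment> \<open>Under the reversed order the super-trajectory \<open>uu\<close> becomes a
    sub-trajectory, and least and greatest solutions exchange roles.\<close>
  interpret upp: attracted_sub_trajectory "\<lambda>x y. y \<le> x" R A uu
  proof unfold_locales
    show "y \<le> x" if "X \<longlonglongrightarrow> x" "Y \<longlonglongrightarrow> y" "\<And>n. Y n \<le> X n"
      for X Y :: "nat \<Rightarrow> 'a" and x y
      using that(2,1,3) by (rule order_closed_sequentially)
    show "dist v w \<le> dist a w" if "v \<le> a" "w \<le> v" for a v w :: 'a
      using dist_mono_left[OF that(2,1)] by (simp add: dist_commute)
    show "y \<le> uu t" if "s \<le> t" "y \<in> process R t s (uu s)" for s t y
      using assms(8) that unfolding complete_super_trajectory_def by blast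
  qed (use assms attractor tube
      strongly_order_preserving_least[OF assms(5)]
      strongly_order_preserving_greatest[OF assms(5)] in auto)
  have bdd: "bounded (range low.limit_orbit) \<and> bounded (range upp.limit_orbit)"
    if "bounded (\<Union>s. A s)"
    using low.limit_orbit_in upp.limit_orbit_in by (auto intro!: bounded_subset[OF that])
  show ?thesis
  proof (rule exI[of _ low.limit_orbit], rule exI[of _ upp.limit_orbit], intro conjI impI allI notI)
    show "A t \<subseteq> order_tube low.limit_orbit upp.limit_orbit t" for t
      unfolding order_tube_def
      using low.limit_orbit_le_attractor upp.limit_orbit_le_attractor by blast
    \<comment> \<open>The upper orbit takes values in the attractor, whose points all lie above the
      lower orbit.\<close>
    show "low.limit_orbit t \<le> upp.limit_orbit t" for t
      by (rule low.limit_orbit_le_attractor[OF upp.limit_orbit_in])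
    show False if "\<exists>\<gamma>. complete_orbit R \<gamma> \<and> \<gamma> \<noteq> low.limit_orbit \<and>
        (\<forall>t. ul t \<le> \<gamma> t \<and> \<gamma> t \<le> low.limit_orbit t)"
      using that low.limit_orbit_minimal by blast
    show False if "\<exists>\<gamma>. complete_orbit R \<gamma> \<and> \<gamma> \<noteq> upp.limit_orbit \<and>
        (\<forall>t. upp.limit_orbit t \<le> \<gamma> t \<and> \<gamma> t \<le> uu t)"
      using that upp.limit_orbit_minimal by blast
    show "((\<lambda>\<tau>. semidist (process R t \<tau> (v \<tau>)) {low.limit_orbit t}) \<longlongrightarrow> 0) at_bot"
      if "forward_unique R low.limit_orbit" "\<forall>\<tau>. ul \<tau> \<le> v \<tau> \<and> v \<tau> \<le> low.limit_orbit \<tau>"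
      for v t
      by (rule low.limit_orbit_stable[OF that(1)]) (use that(2) in auto)
    show "((\<lambda>\<tau>. semidist (process R t \<tau> (v \<tau>)) {upp.limit_orbit t}) \<longlongrightarrow> 0) at_bot"
      if "forward_unique R upp.limit_orbit" "\<forall>\<tau>. v \<tau> \<le> uu \<tau> \<and> upp.limit_orbit \<tau> \<le> v \<tau>"
      for v t
      by (rule upp.limit_orbit_stable[OF that(1)]) (use that(2) in auto)
  qed (simp_all add: bdd tube low.limit_orbit_in upp.limit_orbit_in
      low.limit_orbit_complete upp.limit_orbit_complete)
qed

end
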